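(* Let $Y_1,\dots,Y_N\in\mathbb{P}_n$. The problem $$\min_{X\succ0,\ t\in\mathbb{R}}\ t\quad\text{subject to}\quad e^{-t}Y_i\preceq X\preceq e^{t}Y_i\ \text{ for all } i=1,\dots,N$$ (whose optimal value is $t^\star=\min_{X\succ0}\max_i d_\infty(X,Y_i)$) can be reformulated, via $\xi=e^t$ and $\tau=e^{-t}$, as the convex optimization problem $$\min_{X\succeq0,\ \xi>0,\ \tau\in\mathbb{R}}\ \xi\quad\text{subject to}\quad \tau Y_i\preceq X\preceq\xi Y_i\ \text{ for all } i=1,\dots,N,\qquad \frac1\xi-\tau\le0 .$$ That is: the feasible set of the second problem is convex, its optimal value is $\xi^\star=e^{t^\star}$, and a matrix $X$ satisfies $\max_i d_\infty(X,Y_i)=t^\star$ with $X\succ 0$ if and only if there is $\tau\in\mathbb{R}$ such that $(X,\xi^\star,\tau)$ is a minimizer of the second problem.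
   Context: $\mathbb{P}_n$ is the set of $n\times n$ complex Hermitian positive definite matrices. For Hermitian matrices, $X\succ0$ (resp. $X\succeq0$) means positive definite (resp. semidefinite), and $X\preceq Y$ means $Y-X\succeq0$. The Thompson metric on $\mathbb{P}_n$ is $d_\infty(A,B)=\|\log(A^{-1/2}BA^{-1/2})\|_\infty=\log\max\{\lambda_{\max}(AB^{-1}),\lambda_{\max}(BA^{-1})\}$, where $\|\cdot\|_\infty$ is the spectral norm. *)

theory Defs
  imports "HOL-Analysis.Analysis"
begin

definition conj_transpose :: "complex^'n^'m \<Rightarrow> complex^'m^'n" where
  "conj_transpose A = (\<chi> i j. cnj (A $ j $ i))"

definition hermitian :: "complex^'n^'n \<Rightarrow> bool" where
  "hermitian A \<longleftrightarrow> conj_transpose A = A"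

definition unitary :: "complex^'n^'n \<Rightarrow> bool" where
  "unitary U \<longleftrightarrow> conj_transpose U ** U = mat 1 \<and> U ** conj_transpose U = mat 1"

definition quad_form :: "complex^'n^'n \<Rightarrow> complex^'n \<Rightarrow> complex" where
  "quad_form A x = (\<Sum>i\<in>UNIV. cnj (x $ i) * (A *v x) $ i)"

text \<open>For Hermitian matrices the quadratic form is real-valued, so taking the real part below
  loses nothing.\<close>

definition pos_semidef :: "complex^'n^'n \<Rightarrow> bool" where
  "pos_semidef A \<longleftrightarrow> hermitian A \<and> (\<forall>x. 0 \<le> Re (quad_form A x))"

definition pos_def :: "complex^'n^'n \<Rightarrow> bool" where
  "pos_def A \<longleftrightarrow> hermitian A \<and> (\<forall>x. x \<noteq> 0 \<longrightarrow> 0 < Re (quad_form A x))"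

definition loewner_le :: "complex^'n^'n \<Rightarrow> complex^'n^'n \<Rightarrow> bool"  (infix "\<preceq>\<^sub>L" 50) where
  "X \<preceq>\<^sub>L Y \<longleftrightarrow> pos_semidef (Y - X)"

definition real_diag :: "('n \<Rightarrow> real) \<Rightarrow> complex^'n^'n" where
  "real_diag d = (\<chi> i j. if i = j then complex_of_real (d i) else 0)"

text \<open>Functional calculus: if \<open>A = U diag(d) U\<^sup>*\<close> with \<open>U\<close> unitary and \<open>d\<close> real, then
  \<open>f(A) = U diag(f \<circ> d) U\<^sup>*\<close>. By the spectral theorem such a decomposition exists for every
  Hermitian \<open>A\<close>, and the result does not depend on the decomposition chosen. For \<open>A\<close> not
  Hermitian the value is unspecified.\<close>

definition matrix_fun :: "(real \<Rightarrow> real) \<Rightarrow> complex^'n^'n \<Rightarrow> complex^'n^'n" where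
  "matrix_fun f A = (THE C. \<exists>U d. unitary U \<and> A = U ** real_diag d ** conj_transpose U \<and>
                                  C = U ** real_diag (f \<circ> d) ** conj_transpose U)"

definition matrix_log :: "complex^'n^'n \<Rightarrow> complex^'n^'n" where
  "matrix_log = matrix_fun ln"

definition matrix_inv_sqrt :: "complex^'n^'n \<Rightarrow> complex^'n^'n" where
  "matrix_inv_sqrt = matrix_fun (\<lambda>x. 1 / sqrt x)"

text \<open>The norm of \<^typ>\<open>complex^'n\<close> is the Euclidean one, so its operator norm is the spectral
  norm.\<close>

definition spectral_norm :: "complex^'n^'n \<Rightarrow> real" where
  "spectral_norm A = onorm (\<lambda>x. A *v x)"

definition thompson_dist :: "complex^'n^'n \<Rightarrow> complex^'n^'n \<Rightarrow> real" where
  "thompson_dist A B =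
     spectral_norm (matrix_log (matrix_inv_sqrt A ** B ** matrix_inv_sqrt A))"

definition max_thompson_dist :: "(nat \<Rightarrow> complex^'n^'n) \<Rightarrow> nat \<Rightarrow> complex^'n^'n \<Rightarrow> real" where
  "max_thompson_dist Y N X = Max ((\<lambda>i. thompson_dist X (Y i)) ` {1..N})"

definition feasible_orig :: "(nat \<Rightarrow> complex^'n^'n) \<Rightarrow> nat \<Rightarrow> ((complex^'n^'n) \<times> real) set" where
  "feasible_orig Y N = {(X, t). pos_def X \<and>
     (\<forall>i\<in>{1..N}. exp (- t) *\<^sub>R Y i \<preceq>\<^sub>L X \<and> X \<preceq>\<^sub>L exp t *\<^sub>R Y i)}"

definition feasible_conv ::
    "(nat \<Rightarrow> complex^'n^'n) \<Rightarrow> nat \<Rightarrow> ((complex^'n^'n) \<times> real \<times> real) set" where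
  "feasible_conv Y N = {(X, \<xi>, \<tau>). pos_semidef X \<and> \<xi> > 0 \<and>
     (\<forall>i\<in>{1..N}. \<tau> *\<^sub>R Y i \<preceq>\<^sub>L X \<and> X \<preceq>\<^sub>L \<xi> *\<^sub>R Y i) \<and> 1 / \<xi> - \<tau> \<le> 0}"

text \<open>The optimal value of a minimization problem includes that the minimum is attained.\<close>

definition is_min_value :: "('a \<Rightarrow> real) \<Rightarrow> 'a set \<Rightarrow> real \<Rightarrow> bool" where
  "is_min_value f S v \<longleftrightarrow> (\<exists>x. is_arg_min f (\<lambda>x. x \<in> S) x \<and> f x = v)"

end

(* For Hermitian positive definite A, B the substitution x = A^(-1/2) y and the spectral theorem for
   A^(-1/2) B A^(-1/2) turn d(A,B) <= t into the two Loewner inequalities e^(-t) B <= A <= e^t B.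
   Hence (X,t) is feasible for the first problem iff X > 0 and max_i d(X,Y_i) <= t, and a minimiser
   exists because bounding t by its value at Y_1 cuts out a compact set.  Any (X,xi,tau) feasible for
   the second problem stays feasible when tau is lowered to 1/xi, so (X, ln xi) is feasible for the first. *)

theory Submission
  imports Defs
begin

section \<open>The complex inner product and quadratic forms\<close>

text \<open>\<open>matrix_fun\<close> is a definite description, so the Thompson distance says
  nothing until a unitary diagonalisation is known to exist and the value is known not to depend on
  it. Order statements and the variational argument use the real inner product
  \<open>\<bullet>\<close>, the real part of the Hermitian form; \<open>cinner\<close> serves where
  orthogonality over the complex numbers matters. Positive definiteness is an open condition,
  whereas compactness calls for closed constraints and the second problem asks only for a
  semidefinite \<open>X\<close>. Both difficulties have one remedy: the lower bound
  \<open>exp (- t) *\<^sub>R Y 1\<close> is itself positive definite and forces \<open>X\<close> to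
  be so. In the variable t the constraint \<open>X \<preceq>\<^sub>L exp t *\<^sub>R Y i\<close> is
  not convex. In \<xi> it is linear, and the equation \<tau> = 1/\<xi>, which would again destroy
  convexity, is relaxed to \<tau> \<ge> 1/\<xi>, the epigraph of a convex function.\<close>

definition cinner :: "complex^'n \<Rightarrow> complex^'n \<Rightarrow> complex" where
  "cinner x y = (\<Sum>i\<in>UNIV. cnj (x $ i) * y $ i)"

lemma Re_cinner: "Re (cinner x y) = x \<bullet> y"
  by (simp add: cinner_def inner_vec_def inner_complex_def)

lemma cinner_self: "cinner x x = complex_of_real ((norm x)\<^sup>2)"
proof -
  have "Im (cinner x x) = 0"
    by (simp add: cinner_def mult.commute)
  then show ?thesis
    by (simp add: complex_eq_iff Re_cinner power2_norm_eq_inner)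
qed

lemma cnj_cinner: "cnj (cinner x y) = cinner y x"
  by (simp add: cinner_def mult.commute)

lemma cinner_scaleR_right: "cinner x (c *\<^sub>R y) = of_real c * cinner x y"
  unfolding scaleR_conv_of_real[symmetric] by (simp add: cinner_def scaleR_sum_right)

lemma cinner_scaleR_left: "cinner (c *\<^sub>R x) y = of_real c * cinner x y"
  unfolding scaleR_conv_of_real[symmetric] by (simp add: cinner_def scaleR_sum_right)

lemma cinner_zero_right [simp]: "cinner x 0 = 0"
  by (simp add: cinner_def)

lemma cinner_add_right: "cinner x (y + z) = cinner x y + cinner x z"
  by (simp add: cinner_def distrib_left sum.distrib)

lemma conj_transpose_conj_transpose [simp]: "conj_transpose (conj_transpose A) = A"
  by (simp add: conj_transpose_def vec_eq_iff)

lemma conj_transpose_mult: "conj_transpose (A ** B) = conj_transpose B ** conj_transpose A"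
  by (simp add: conj_transpose_def vec_eq_iff matrix_matrix_mult_def mult.commute)

lemma cinner_adjoint:
  fixes A :: "complex^'n^'m"
  shows "cinner x (A *v y) = cinner (conj_transpose A *v x) y"
proof -
  have "cinner x (A *v y) = (\<Sum>i\<in>UNIV. \<Sum>j\<in>UNIV. cnj (x $ i) * (A $ i $ j * y $ j))"
    by (simp add: cinner_def matrix_vector_mult_def sum_distrib_left)
  also have "\<dots> = (\<Sum>j\<in>UNIV. \<Sum>i\<in>UNIV. cnj (x $ i) * (A $ i $ j * y $ j))"
    by (rule sum.swap)
  also have "\<dots> = cinner (conj_transpose A *v x) y"
    unfolding cinner_def matrix_vector_mult_def conj_transpose_def
    by (simp add: sum_distrib_right) (intro sum.cong refl, simp add: mult_ac)
  finally show ?thesis .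
qed

lemma inner_adjoint:
  fixes A :: "complex^'n^'m"
  shows "x \<bullet> (A *v y) = (conj_transpose A *v x) \<bullet> y"
  by (metis Re_cinner cinner_adjoint)

lemma Re_quad_form: "Re (quad_form A x) = x \<bullet> (A *v x)"
  unfolding Re_cinner [symmetric] by (simp add: quad_form_def cinner_def)

lemma matrix_vector_mult_scaleR_left:
  fixes A :: "complex^'n^'m"
  shows "(c *\<^sub>R A) *v x = c *\<^sub>R (A *v x)"
  by (simp add: vec_eq_iff matrix_vector_mult_def scaleR_sum_right)

lemma matrix_vector_mult_scaleR_right:
  fixes A :: "complex^'n^'m"
  shows "A *v (c *\<^sub>R x) = c *\<^sub>R (A *v x)"
  by (simp add: vec_eq_iff matrix_vector_mult_def scaleR_sum_right)

lemma linear_matrix_vector_mult: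
  fixes A :: "complex^'n^'m"
  shows "linear ((*v) A)"
  by (intro linearI) (simp_all add: matrix_vector_right_distrib matrix_vector_mult_scaleR_right)

lemma continuous_on_matrix_vector_mult:
  fixes A :: "complex^'n^'m"
  shows "continuous_on S ((*v) A)"
  using linear_matrix_vector_mult linear_continuous_on linear_conv_bounded_linear by blast

lemma hermitian_diff: "hermitian A \<Longrightarrow> hermitian B \<Longrightarrow> hermitian (A - B)"
  by (simp add: hermitian_def conj_transpose_def vec_eq_iff)

lemma hermitian_add: "hermitian A \<Longrightarrow> hermitian B \<Longrightarrow> hermitian (A + B)"
  by (simp add: hermitian_def conj_transpose_def vec_eq_iff)

lemma hermitian_scaleR: "hermitian A \<Longrightarrow> hermitian (c *\<^sub>R A)"
  by (simp add: hermitian_def conj_transpose_def vec_eq_iff)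

lemma hermitian_congruence: "hermitian B \<Longrightarrow> hermitian (conj_transpose S ** B ** S)"
  by (simp add: hermitian_def conj_transpose_mult matrix_mul_assoc)

lemma inner_hermitian: "hermitian A \<Longrightarrow> x \<bullet> (A *v y) = (A *v x) \<bullet> y"
  by (simp add: inner_adjoint hermitian_def)

lemma pos_semidef_iff: "pos_semidef A \<longleftrightarrow> hermitian A \<and> (\<forall>x. 0 \<le> x \<bullet> (A *v x))"
  by (simp add: pos_semidef_def Re_quad_form)

lemma pos_def_iff: "pos_def A \<longleftrightarrow> hermitian A \<and> (\<forall>x. x \<noteq> 0 \<longrightarrow> 0 < x \<bullet> (A *v x))"
  by (simp add: pos_def_def Re_quad_form)

lemma pos_def_imp_hermitian: "pos_def A \<Longrightarrow> hermitian A"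
  by (simp add: pos_def_def)

lemma pos_def_imp_pos_semidef: "pos_def A \<Longrightarrow> pos_semidef A"
  unfolding pos_def_iff pos_semidef_iff by (metis (no_types) inner_zero_left less_eq_real_def)

lemma loewner_le_iff:
  assumes "hermitian X" "hermitian Y"
  shows "X \<preceq>\<^sub>L Y \<longleftrightarrow> (\<forall>x. x \<bullet> (X *v x) \<le> x \<bullet> (Y *v x))"
  using hermitian_diff[OF assms(2,1)]
  by (simp add: loewner_le_def pos_semidef_iff matrix_vector_mult_diff_rdistrib inner_diff_right)

section \<open>The spectral theorem\<close>

text \<open>The form \<open>\<lambda> - A\<close> is nonnegative on \<open>W\<close> and vanishes at a maximiser \<open>v\<close> of the
  Rayleigh quotient, so its first variation at \<open>v\<close> in the direction \<open>\<lambda> v - A v\<close> vanishes.\<close>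

lemma hermitian_eigenvector_in_subspace:
  fixes A :: "complex^'n^'n"
  assumes A: "hermitian A" and W: "subspace W" "W \<noteq> {0}"
    and inv: "\<And>x. x \<in> W \<Longrightarrow> A *v x \<in> W"
  obtains v l where "v \<in> W" "norm v = 1" "A *v v = l *\<^sub>R v"
proof -
  obtain w where w: "w \<in> W" "w \<noteq> 0"
    using W subspace_0 by blast
  let ?S = "sphere 0 1 \<inter> W"
  have "w /\<^sub>R norm w \<in> ?S"
    using w W by (simp add: subspace_scale)
  then have "?S \<noteq> {}" by blast
  moreover have "compact ?S"
    by (intro compact_Int_closed compact_sphere closed_subspace W)
  moreover have "continuous_on ?S (\<lambda>x. x \<bullet> (A *v x))"
    by (intro continuous_intros continuous_on_matrix_vector_mult)
  ultimately obtain v where v: "v \<in> ?S" and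
    vmax: "\<And>x. x \<in> ?S \<Longrightarrow> x \<bullet> (A *v x) \<le> v \<bullet> (A *v v)"
    using continuous_attains_sup[of ?S "\<lambda>x. x \<bullet> (A *v x)"] by blast
  define l where "l = v \<bullet> (A *v v)"
  have vW: "v \<in> W" and nv: "norm v = 1" using v by auto
  have le: "x \<bullet> (A *v x) \<le> l * (x \<bullet> x)" if "x \<in> W" for x
  proof (cases "x = 0")
    case False
    then have "x /\<^sub>R norm x \<in> ?S"
      using that W by (simp add: subspace_scale)
    from vmax[OF this] have "(x \<bullet> (A *v x)) / (norm x)\<^sup>2 \<le> l"
      by (simp add: l_def matrix_vector_mult_scaleR_right power2_eq_square divide_inverse mult_ac)
    then show ?thesis
      using False by (simp add: divide_le_eq power2_norm_eq_inner)
  qed simp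
  define u where "u = l *\<^sub>R v - A *v v"
  have uW: "u \<in> W"
    unfolding u_def using W vW inv by (simp add: subspace_diff subspace_scale)
  define c where "c = l * (u \<bullet> u) - u \<bullet> (A *v u)"
  have c0: "c \<ge> 0" using le[OF uW] by (simp add: c_def)
  have var: "0 \<le> 2 * t * (u \<bullet> u) + t\<^sup>2 * c" for t :: real
  proof -
    have "v + t *\<^sub>R u \<in> W"
      using W vW uW by (simp add: subspace_add subspace_scale)
    from le[OF this] have "0 \<le> l * ((v + t *\<^sub>R u) \<bullet> (v + t *\<^sub>R u))
        - (v + t *\<^sub>R u) \<bullet> (A *v (v + t *\<^sub>R u))"
      by simp
    also have "\<dots> = (l * (v \<bullet> v) - v \<bullet> (A *v v))
        + 2 * t * (u \<bullet> (l *\<^sub>R v - A *v v)) + t\<^sup>2 * c"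
      using inner_hermitian[OF A, of v u]
      by (simp add: c_def matrix_vector_right_distrib matrix_vector_mult_scaleR_right
          inner_add_left inner_add_right inner_diff_right power2_eq_square algebra_simps
          inner_commute)
    also have "l * (v \<bullet> v) - v \<bullet> (A *v v) = 0"
      using nv by (simp add: l_def norm_eq_1)
    finally show ?thesis by (simp add: u_def)
  qed
  have "u \<bullet> u = 0"
  proof (rule ccontr)
    assume "u \<bullet> u \<noteq> 0"
    then have p: "u \<bullet> u > 0" by simp
    \<comment> \<open>With this t the bound in \<open>var\<close> collapses to t (u \<bullet> u) -
      t^2 < 0. The summand 1 keeps the denominator positive when c = 0.\<close>
    define t where "t = - (u \<bullet> u) / (c + 1)"
    have "t * (c + 1) = - (u \<bullet> u)" using c0 by (simp add: t_def)
    then have "2 * t * (u \<bullet> u) + t\<^sup>2 * c = t * (u \<bullet> u) - t\<^sup>2"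
      by algebra
    moreover have "t < 0" using p c0 by (simp add: t_def divide_neg_pos)
    then have "t * (u \<bullet> u) < 0" using p by (simp add: mult_neg_pos)
    ultimately show False using var[of t] zero_le_power2[of t] by linarith
  qed
  then have "A *v v = l *\<^sub>R v" by (simp add: u_def)
  with vW nv that show thesis by blast
qed

text \<open>The orthogonal complement of the eigenvectors already found is invariant under
  \<open>A\<close> and, as long as an index is missing from \<open>J\<close>, nonzero; so it
  contains another unit eigenvector. Indexing by subsets of \<open>'n\<close> lets
  \<open>J = UNIV\<close> supply exactly the columns of a square matrix.\<close>

lemma hermitian_orthonormal_eigenvectors:
  fixes A :: "complex^'n^'n" and J :: "'n set"
  assumes A: "hermitian A"
  shows "\<exists>v l. (\<forall>i\<in>J. \<forall>j\<in>J. cinner (v i) (v j) = (if i = j then 1 else 0)) \<and>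
               (\<forall>j\<in>J. A *v v j = l j *\<^sub>R v j)"
  using finite[of J]
proof (induction J rule: finite_induct)
  case empty
  show ?case by simp
next
  case (insert k J)
  then obtain v l where
    orth: "\<And>i j. i \<in> J \<Longrightarrow> j \<in> J \<Longrightarrow> cinner (v i) (v j) = (if i = j then 1 else 0)" and
    eig: "\<And>j. j \<in> J \<Longrightarrow> A *v v j = l j *\<^sub>R v j" by blast
  define W where "W = {x. \<forall>j\<in>J. cinner (v j) x = 0}"
  have "subspace W"
    by (auto simp: W_def subspace_def cinner_add_right cinner_scaleR_right)
  moreover have "W \<noteq> {0}"
  proof
    \<comment> \<open>The equations defining \<open>W\<close> form a square system whose \<open>k\<close>-th row vanishes.\<close>
    assume W0: "W = {0}"
    define M :: "complex^'n^'n" where "M = (\<chi> i j. if i \<in> J then cnj (v i $ j) else 0)"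
    have M: "(M *v x) $ i = (if i \<in> J then cinner (v i) x else 0)" for x i
      by (simp add: M_def matrix_vector_mult_def cinner_def)
    have "\<forall>x. M *v x = 0 \<longrightarrow> x = 0"
    proof (intro allI impI)
      fix x assume "M *v x = 0"
      then have "cinner (v j) x = 0" if "j \<in> J" for j
        using M[of x j] that by simp
      then have "x \<in> W" by (simp add: W_def)
      then show "x = 0" using W0 by simp
    qed
    then obtain B where "B ** M = mat 1"
      using matrix_left_invertible_ker by blast
    then have "M ** B = mat 1"
      using matrix_left_right_inverse by blast
    then have "(M ** B) $ k $ k = 1" by (simp add: mat_def)
    moreover have "(M ** B) $ k $ k = 0"
      using insert.hyps by (simp add: M_def matrix_matrix_mult_def)
    ultimately show False by simp
  qed
  moreover have "A *v x \<in> W" if "x \<in> W" for x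
  proof -
    have "cinner (v j) (A *v x) = 0" if "j \<in> J" for j
    proof -
      have "cinner (v j) (A *v x) = cinner (A *v v j) x"
        using A by (simp add: cinner_adjoint hermitian_def)
      then show ?thesis
        using \<open>x \<in> W\<close> that by (simp add: eig cinner_scaleR_left W_def)
    qed
    then show ?thesis by (simp add: W_def)
  qed
  ultimately obtain w m where w: "w \<in> W" "norm w = 1" "A *v w = m *\<^sub>R w"
    using hermitian_eigenvector_in_subspace[OF A, of W] by blast
  have wv: "cinner (v j) w = 0" if "j \<in> J" for j
    using w(1) that by (simp add: W_def)
  then have vw: "cinner w (v j) = 0" if "j \<in> J" for j
    using that cnj_cinner[of "v j" w] by simp
  have ww: "cinner w w = 1" using w(2) by (simp add: cinner_self)
  show ?case
  proof (intro exI conjI ballI)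
    fix i j assume "i \<in> insert k J" "j \<in> insert k J"
    then show "cinner ((v(k := w)) i) ((v(k := w)) j) = (if i = j then 1 else 0)"
      using insert.hyps orth wv vw ww by auto
  next
    fix j assume "j \<in> insert k J"
    then show "A *v (v(k := w)) j = (l(k := m)) j *\<^sub>R (v(k := w)) j"
      using insert.hyps eig w(3) by auto
  qed
qed

lemma real_diag_mult_vec: "(real_diag d *v x) $ i = d i *\<^sub>R x $ i"
proof -
  have "(real_diag d *v x) $ i = (\<Sum>j\<in>UNIV. if i = j then d i *\<^sub>R x $ j else 0)"
    unfolding real_diag_def matrix_vector_mult_def vec_lambda_beta
    by (intro sum.cong) (auto simp: scaleR_conv_of_real)
  then show ?thesis by simp
qed

lemma matrix_mult_real_diag: "(M ** real_diag d) $ i $ j = M $ i $ j * of_real (d j)"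
proof -
  have "(M ** real_diag d) $ i $ j = (\<Sum>k\<in>UNIV. if k = j then M $ i $ k * of_real (d k) else 0)"
    unfolding real_diag_def matrix_matrix_mult_def vec_lambda_beta
    by (intro sum.cong) (auto simp: scaleR_conv_of_real)
  then show ?thesis by simp
qed

lemma real_diag_mult_matrix: "(real_diag d ** M) $ i $ j = of_real (d i) * M $ i $ j"
proof -
  have "(real_diag d ** M) $ i $ j = (\<Sum>k\<in>UNIV. if i = k then of_real (d i) * M $ k $ j else 0)"
    unfolding real_diag_def matrix_matrix_mult_def vec_lambda_beta
    by (intro sum.cong) (auto simp: scaleR_conv_of_real)
  then show ?thesis by simp
qed

text \<open>The orthonormal eigenvectors become the columns of \<open>U\<close>: orthonormality is
  the unitarity of \<open>U\<close>, and the eigenvalue equations read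
  \<open>A ** U = U ** real_diag d\<close>.\<close>

theorem spectral_decomposition:
  fixes A :: "complex^'n^'n"
  assumes "hermitian A"
  obtains U d where "unitary U" "A = U ** real_diag d ** conj_transpose U"
proof -
  obtain v :: "'n \<Rightarrow> complex^'n" and d where
    "\<forall>i\<in>UNIV. \<forall>j\<in>UNIV. cinner (v i) (v j) = (if i = j then 1 else 0)" and
    "\<forall>j\<in>UNIV. A *v v j = d j *\<^sub>R v j"
    using hermitian_orthonormal_eigenvectors[OF assms, of UNIV] by blast
  then have orth: "cinner (v i) (v j) = (if i = j then 1 else 0)"
    and eig: "A *v v j = d j *\<^sub>R v j" for i j
    by simp_all
  define U :: "complex^'n^'n" where "U = (\<chi> i j. v j $ i)"
  have "conj_transpose U ** U = mat 1"
    using orth by (simp add: vec_eq_iff conj_transpose_def U_def matrix_matrix_mult_def mat_def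
        cinner_def)
  then have U: "unitary U"
    using matrix_left_right_inverse unitary_def by blast
  have "(A ** U) $ i $ j = (U ** real_diag d) $ i $ j" for i j
  proof -
    have "(A ** U) $ i $ j = (A *v v j) $ i"
      by (simp add: U_def matrix_matrix_mult_def matrix_vector_mult_def)
    also have "\<dots> = d j *\<^sub>R U $ i $ j"
      by (simp add: eig U_def)
    finally show ?thesis
      by (simp only: matrix_mult_real_diag scaleR_conv_of_real mult.commute)
  qed
  then have "A ** U = U ** real_diag d" by (simp add: vec_eq_iff)
  then have "U ** real_diag d ** conj_transpose U = A ** (U ** conj_transpose U)"
    by (simp add: matrix_mul_assoc)
  with U have "A = U ** real_diag d ** conj_transpose U"
    by (simp add: unitary_def)
  with U that show thesis by blast
qed

section \<open>Functional calculus and the spectral norm\<close>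

text \<open>The matrix \<open>W = conj_transpose V ** U\<close> intertwines the two diagonal
  matrices, so an entry of \<open>W\<close> vanishes unless the eigenvalues at its row and column
  agree. Applying \<open>f\<close> to both diagonals preserves this relation.\<close>

lemma spectral_calculus_unique:
  assumes U: "unitary U" and V: "unitary V"
    and eq: "U ** real_diag d ** conj_transpose U = V ** real_diag e ** conj_transpose V"
  shows "U ** real_diag (f \<circ> d) ** conj_transpose U = V ** real_diag (f \<circ> e) ** conj_transpose V"
proof -
  define W where "W = conj_transpose V ** U"
  have UU: "conj_transpose U ** U = mat 1" "U ** conj_transpose U = mat 1"
    and VV: "conj_transpose V ** V = mat 1" "V ** conj_transpose V = mat 1"
    using U V by (auto simp: unitary_def)
  have "W ** real_diag d = conj_transpose V ** (U ** real_diag d ** conj_transpose U) ** U"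
    by (simp add: W_def UU flip: matrix_mul_assoc)
  also have "\<dots> = (conj_transpose V ** V) ** real_diag e ** W"
    unfolding eq by (simp add: W_def matrix_mul_assoc)
  finally have "W ** real_diag d = real_diag e ** W"
    by (simp add: VV)
  then have "W $ i $ j * of_real (d j) = of_real (e i) * W $ i $ j" for i j
    by (metis matrix_mult_real_diag real_diag_mult_matrix)
  then have "W $ i $ j = 0 \<or> d j = e i" for i j
    by (metis mult.commute mult_cancel_left of_real_eq_iff)
  then have "(W ** real_diag (f \<circ> d)) $ i $ j = (real_diag (f \<circ> e) ** W) $ i $ j" for i j
    unfolding matrix_mult_real_diag real_diag_mult_matrix comp_def
    by (metis mult.commute mult_zero_left)
  then have W: "W ** real_diag (f \<circ> d) = real_diag (f \<circ> e) ** W"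
    by (simp add: vec_eq_iff)
  have "U ** real_diag (f \<circ> d) ** conj_transpose U
      = (V ** conj_transpose V) ** U ** real_diag (f \<circ> d) ** conj_transpose U"
    by (simp add: VV)
  also have "\<dots> = V ** (W ** real_diag (f \<circ> d)) ** conj_transpose U"
    by (simp add: W_def matrix_mul_assoc)
  also have "\<dots> = V ** real_diag (f \<circ> e) ** conj_transpose V ** (U ** conj_transpose U)"
    unfolding W by (simp add: W_def matrix_mul_assoc)
  finally show ?thesis by (simp add: UU)
qed

lemma matrix_fun_eq:
  assumes "unitary U"
  shows "matrix_fun f (U ** real_diag d ** conj_transpose U)
       = U ** real_diag (f \<circ> d) ** conj_transpose U"
  unfolding matrix_fun_def
  by (rule the_equality) (use assms spectral_calculus_unique in metis)+

lemma norm_unitary_mult: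
  assumes "conj_transpose U ** U = mat 1"
  shows "norm (U *v x) = norm x"
proof -
  have "(U *v x) \<bullet> (U *v x) = x \<bullet> x"
    using assms by (simp add: inner_adjoint matrix_vector_mul_assoc)
  then show ?thesis by (simp add: norm_eq)
qed

lemma inner_spectral_form:
  "x \<bullet> ((U ** real_diag d ** conj_transpose U) *v x)
     = (\<Sum>i\<in>UNIV. d i * (norm ((conj_transpose U *v x) $ i))\<^sup>2)"
proof -
  have "x \<bullet> ((U ** real_diag d ** conj_transpose U) *v x)
      = (conj_transpose U *v x) \<bullet> (real_diag d *v (conj_transpose U *v x))"
    by (simp add: inner_adjoint flip: matrix_vector_mul_assoc)
  then show ?thesis
    by (simp add: inner_vec_def real_diag_mult_vec power2_norm_eq_inner)
qed

lemma norm_axis_one: "norm (axis k (1::complex)) = 1"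
  by (simp add: norm_eq_1 inner_axis_axis)

lemma inner_spectral_form_axis:
  assumes "unitary U"
  shows "(U *v axis k 1) \<bullet> ((U ** real_diag d ** conj_transpose U) *v (U *v axis k 1)) = d k"
proof -
  have "conj_transpose U *v (U *v axis k 1) = axis k 1"
    using assms by (simp add: matrix_vector_mul_assoc unitary_def)
  then have "(U *v axis k 1) \<bullet> ((U ** real_diag d ** conj_transpose U) *v (U *v axis k 1))
      = (\<Sum>i\<in>UNIV. d i * (norm (axis k (1::complex) $ i))\<^sup>2)"
    by (simp only: inner_spectral_form)
  also have "\<dots> = (\<Sum>i\<in>UNIV. if i = k then d i else 0)"
    by (intro sum.cong) (auto simp: axis_def)
  finally show ?thesis by simp
qed

text \<open>The k-th column of \<open>U\<close> is a unit vector at which the form takes the value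
  \<open>d k\<close>. Conversely, the form is diagonal in the coordinates
  \<open>conj_transpose U *v x\<close>, and these have the same norm as \<open>x\<close>.\<close>

lemma spectral_form_le_iff:
  assumes U: "unitary U"
  shows "(\<forall>x. x \<bullet> ((U ** real_diag d ** conj_transpose U) *v x) \<le> c * (norm x)\<^sup>2)
         \<longleftrightarrow> (\<forall>i. d i \<le> c)" (is "?L \<longleftrightarrow> ?R")
proof
  assume L: ?L
  show ?R
  proof
    fix i
    have "norm (U *v axis i 1) = 1"
      using U by (simp add: norm_unitary_mult unitary_def norm_axis_one)
    then show "d i \<le> c"
      using L[rule_format, of "U *v axis i 1"] by (simp add: inner_spectral_form_axis[OF U])
  qed
next
  assume R: ?R
  show ?L
  proof
    fix x
    let ?y = "conj_transpose U *v x"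
    have "x \<bullet> ((U ** real_diag d ** conj_transpose U) *v x) \<le> (\<Sum>i\<in>UNIV. c * (norm (?y $ i))\<^sup>2)"
      unfolding inner_spectral_form using R by (intro sum_mono mult_right_mono) auto
    also have "\<dots> = c * (norm ?y)\<^sup>2"
      by (simp add: power2_norm_eq_inner inner_vec_def sum_distrib_left)
    also have "norm ?y = norm x"
      using U by (simp add: norm_unitary_mult unitary_def)
    finally show "x \<bullet> ((U ** real_diag d ** conj_transpose U) *v x) \<le> c * (norm x)\<^sup>2" .
  qed
qed

lemma spectral_form_ge_iff:
  assumes U: "unitary U"
  shows "(\<forall>x. c * (norm x)\<^sup>2 \<le> x \<bullet> ((U ** real_diag d ** conj_transpose U) *v x))
         \<longleftrightarrow> (\<forall>i. c \<le> d i)"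
proof -
  have "x \<bullet> ((U ** real_diag (\<lambda>i. - d i) ** conj_transpose U) *v x)
      = - (x \<bullet> ((U ** real_diag d ** conj_transpose U) *v x))" for x
    by (simp add: inner_spectral_form sum_negf)
  then show ?thesis
    using spectral_form_le_iff[OF U, of "\<lambda>i. - d i" "- c"] by simp
qed

lemma pos_def_spectral_pos:
  assumes "unitary U" "pos_def (U ** real_diag d ** conj_transpose U)"
  shows "d i > 0"
proof -
  have "norm (U *v axis i 1) = 1"
    using assms(1) by (simp add: norm_unitary_mult unitary_def norm_axis_one)
  then have "U *v axis i 1 \<noteq> 0" by auto
  then show ?thesis
    using assms(2) inner_spectral_form_axis[OF assms(1), of i d] by (metis pos_def_iff)
qed

text \<open>Cauchy-Schwarz at a unit eigenvector bounds each eigenvalue by the operator norm;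
  conversely the diagonal factor stretches each coordinate by at most t, and the unitary factors
  preserve norms.\<close>

lemma spectral_norm_le_iff:
  assumes U: "unitary U"
  shows "spectral_norm (U ** real_diag d ** conj_transpose U) \<le> t \<longleftrightarrow> (\<forall>i. \<bar>d i\<bar> \<le> t)"
    (is "spectral_norm ?M \<le> t \<longleftrightarrow> _")
proof
  assume L: "spectral_norm ?M \<le> t"
  show "\<forall>i. \<bar>d i\<bar> \<le> t"
  proof
    fix i
    let ?x = "U *v axis i 1"
    have n: "norm ?x = 1"
      using U by (simp add: norm_unitary_mult unitary_def norm_axis_one)
    have "\<bar>d i\<bar> = \<bar>?x \<bullet> (?M *v ?x)\<bar>"
      by (simp only: inner_spectral_form_axis[OF U])
    also have "\<dots> \<le> norm ?x * norm (?M *v ?x)"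
      by (rule Cauchy_Schwarz_ineq2)
    also have "\<dots> \<le> onorm ((*v) ?M) * norm ?x"
      using onorm[of "(*v) ?M" ?x] linear_matrix_vector_mult[of ?M] n
      by (simp add: linear_conv_bounded_linear)
    also have "\<dots> \<le> t" using L n by (simp add: spectral_norm_def)
    finally show "\<bar>d i\<bar> \<le> t" .
  qed
next
  assume R: "\<forall>i. \<bar>d i\<bar> \<le> t"
  \<comment> \<open>Index types are nonempty, so t dominates the absolute value of at least one
    eigenvalue.\<close>
  then have t: "t \<ge> 0" by (meson abs_ge_zero order_trans)
  have "norm (?M *v x) \<le> t * norm x" for x
  proof -
    let ?y = "conj_transpose U *v x"
    have "norm (?M *v x) = norm (real_diag d *v ?y)"
      using U by (simp add: norm_unitary_mult unitary_def flip: matrix_vector_mul_assoc)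
    also have "\<dots> \<le> norm (t *\<^sub>R ?y)"
      by (rule norm_le_componentwise_cart)
        (use R t in \<open>simp add: real_diag_mult_vec mult_right_mono\<close>)
    also have "\<dots> = t * norm x"
      using U t by (simp add: norm_unitary_mult unitary_def)
    finally show ?thesis .
  qed
  then show "spectral_norm ?M \<le> t"
    unfolding spectral_norm_def by (intro onorm_le) simp
qed

section \<open>The Thompson metric and the Loewner order\<close>

text \<open>These two properties are all that the comparison with the Loewner order uses of the
  inverse square root. In an eigenbasis of \<open>A\<close> the second one is the scalar identity g
  d g = 1 for g = 1 / sqrt d, with d > 0.\<close>

lemma pos_def_inv_sqrt:
  fixes A :: "complex^'n^'n"
  assumes "pos_def A"
  shows "hermitian (matrix_inv_sqrt A)" "matrix_inv_sqrt A ** A ** matrix_inv_sqrt A = mat 1"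
proof -
  obtain U d where U: "unitary U" and A: "A = U ** real_diag d ** conj_transpose U"
    using spectral_decomposition assms pos_def_imp_hermitian by blast
  have d: "d i > 0" for i using pos_def_spectral_pos U A assms by blast
  define g where "g = (\<lambda>x. 1 / sqrt x) \<circ> d"
  have S: "matrix_inv_sqrt A = U ** real_diag g ** conj_transpose U"
    unfolding A matrix_inv_sqrt_def matrix_fun_eq[OF U] g_def ..
  have "conj_transpose (real_diag g) = real_diag g"
    by (simp add: conj_transpose_def real_diag_def vec_eq_iff)
  then show "hermitian (matrix_inv_sqrt A)"
    by (simp add: S hermitian_def conj_transpose_mult matrix_mul_assoc)
  have "(real_diag g ** real_diag d ** real_diag g) $ i $ j = (mat 1 :: complex^'n^'n) $ i $ j"
    for i j
  proof -
    have "sqrt (d i) * sqrt (d i) = d i" using d[of i] by simp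
    then have "g i * (d i * g i) = 1"
      using d[of i] by (simp add: g_def field_simps)
    then have "complex_of_real (g i) * (complex_of_real (d i) * complex_of_real (g i)) = 1"
      by (metis of_real_1 of_real_mult)
    then show ?thesis
      by (simp add: matrix_mult_real_diag real_diag_mult_matrix)
        (auto simp: real_diag_def mat_def mult_ac)
  qed
  then have g: "real_diag g ** real_diag d ** real_diag g = mat 1"
    by (simp add: vec_eq_iff)
  have "matrix_inv_sqrt A ** A ** matrix_inv_sqrt A
      = U ** real_diag g ** (conj_transpose U ** U) ** real_diag d
          ** (conj_transpose U ** U) ** real_diag g ** conj_transpose U"
    unfolding S unfolding A by (simp add: matrix_mul_assoc)
  also have "\<dots> = U ** (real_diag g ** real_diag d ** real_diag g) ** conj_transpose U"
    using U by (simp add: unitary_def matrix_mul_assoc)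
  finally show "matrix_inv_sqrt A ** A ** matrix_inv_sqrt A = mat 1"
    using U by (simp add: g unitary_def)
qed

lemma thompson_dist_le_iff:
  fixes A B :: "complex^'n^'n"
  assumes A: "pos_def A" and B: "pos_def B"
  shows "thompson_dist A B \<le> t \<longleftrightarrow> exp (- t) *\<^sub>R B \<preceq>\<^sub>L A \<and> A \<preceq>\<^sub>L exp t *\<^sub>R B"
proof -
  define S where "S = matrix_inv_sqrt A"
  define M where "M = S ** B ** S"
  have S: "conj_transpose S = S" and SAS: "S ** A ** S = mat 1"
    using pos_def_inv_sqrt[OF A] by (auto simp: S_def hermitian_def)
  have hA: "hermitian A" and hB: "hermitian B"
    using A B by (auto intro: pos_def_imp_hermitian)
  have SAS': "S ** (A ** S) = mat 1" using SAS by (simp add: matrix_mul_assoc)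
  \<comment> \<open>Since \<open>S ** A ** S\<close> is the identity, \<open>A ** S\<close> is a
    right inverse of \<open>S\<close>. Quantifying over all \<open>S *v y\<close> is therefore the
    same as quantifying over all x.\<close>
  have surj: "\<exists>y. x = S *v y" for x
  proof
    show "x = S *v ((A ** S) *v x)"
      by (simp only: matrix_vector_mul_assoc SAS' matrix_vector_mul_lid)
  qed
  have hM: "hermitian M"
    using hermitian_congruence[OF hB, of S] by (simp add: M_def S)
  have qM: "y \<bullet> (M *v y) = (S *v y) \<bullet> (B *v (S *v y))" for y
    by (simp add: M_def inner_adjoint[of y S] S flip: matrix_vector_mul_assoc)
  have "y \<bullet> ((S ** A ** S) *v y) = (S *v y) \<bullet> (A *v (S *v y))" for y
    by (simp add: inner_adjoint[of y S] S flip: matrix_vector_mul_assoc)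
  \<comment> \<open>The Euclidean norm of y is the \<open>A\<close>-form at \<open>S *v y\<close>,
    so comparing \<open>M\<close> with multiples of the identity amounts to comparing
    \<open>B\<close> with multiples of \<open>A\<close>.\<close>
  then have qA: "(S *v y) \<bullet> (A *v (S *v y)) = (norm y)\<^sup>2" for y
    by (simp add: SAS power2_norm_eq_inner)
  obtain V m where V: "unitary V" and M: "M = V ** real_diag m ** conj_transpose V"
    using spectral_decomposition[OF hM] by blast
  have "pos_def M"
    unfolding pos_def_iff
  proof (intro conjI hM allI impI)
    fix y :: "complex^'n" assume "y \<noteq> 0"
    then have "S *v y \<noteq> 0" using qA[of y] by auto
    then show "0 < y \<bullet> (M *v y)" using B by (simp add: qM pos_def_iff)
  qed
  then have m: "m i > 0" for i using pos_def_spectral_pos V M by blast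
  have "thompson_dist A B \<le> t \<longleftrightarrow> (\<forall>i. \<bar>ln (m i)\<bar> \<le> t)"
    unfolding thompson_dist_def S_def[symmetric] M_def[symmetric] matrix_log_def
    unfolding M matrix_fun_eq[OF V] spectral_norm_le_iff[OF V] by simp
  also have "\<dots> \<longleftrightarrow> (\<forall>i. exp (- t) \<le> m i) \<and> (\<forall>i. m i \<le> exp t)"
  proof -
    have "\<bar>ln (m i)\<bar> \<le> t \<longleftrightarrow> exp (- t) \<le> m i \<and> m i \<le> exp t" for i
      using m[of i] by (smt (verit) exp_le_cancel_iff exp_ln)
    then show ?thesis by auto
  qed
  also have "\<dots> \<longleftrightarrow> (\<forall>y. exp (- t) * (norm y)\<^sup>2 \<le> y \<bullet> (M *v y))
                \<and> (\<forall>y. y \<bullet> (M *v y) \<le> exp t * (norm y)\<^sup>2)"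
    unfolding M spectral_form_le_iff[OF V] spectral_form_ge_iff[OF V] ..
  also have "\<dots> \<longleftrightarrow> (\<forall>x. exp (- t) * (x \<bullet> (A *v x)) \<le> x \<bullet> (B *v x))
                \<and> (\<forall>x. x \<bullet> (B *v x) \<le> exp t * (x \<bullet> (A *v x)))"
    unfolding qM qA[symmetric] using surj by metis
  \<comment> \<open>Multiplying through by \<open>exp t\<close> or \<open>exp (- t)\<close>
    exchanges the roles of \<open>A\<close> and \<open>B\<close>: the lower bound on
    \<open>B\<close> becomes the upper bound on \<open>A\<close>, and conversely.\<close>
  also have "\<dots> \<longleftrightarrow> (\<forall>x. x \<bullet> (A *v x) \<le> exp t * (x \<bullet> (B *v x)))
                \<and> (\<forall>x. exp (- t) * (x \<bullet> (B *v x)) \<le> x \<bullet> (A *v x))"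
    by (simp add: exp_minus field_simps)
  also have "\<dots> \<longleftrightarrow> exp (- t) *\<^sub>R B \<preceq>\<^sub>L A \<and> A \<preceq>\<^sub>L exp t *\<^sub>R B"
    using hA hB
    by (auto simp: loewner_le_iff hermitian_scaleR matrix_vector_mult_scaleR_left)
  finally show ?thesis .
qed

section \<open>The two optimisation problems\<close>

lemma feasible_orig_iff:
  fixes Y :: "nat \<Rightarrow> complex^'n^'n"
  assumes N: "N \<ge> 1" and Y: "\<forall>i\<in>{1..N}. pos_def (Y i)"
  shows "(X, t) \<in> feasible_orig Y N \<longleftrightarrow> pos_def X \<and> max_thompson_dist Y N X \<le> t"
  using N Y by (auto simp: feasible_orig_def max_thompson_dist_def thompson_dist_le_iff)

section \<open>The semidefinite cone and the passage between the two feasible sets\<close>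

lemma pos_semidef_add: "pos_semidef A \<Longrightarrow> pos_semidef B \<Longrightarrow> pos_semidef (A + B)"
  by (simp add: pos_semidef_iff hermitian_add matrix_vector_mult_add_rdistrib inner_add_right)

lemma pos_semidef_scaleR: "pos_semidef A \<Longrightarrow> c \<ge> 0 \<Longrightarrow> pos_semidef (c *\<^sub>R A)"
  by (simp add: pos_semidef_iff hermitian_scaleR matrix_vector_mult_scaleR_left)

lemma loewner_le_trans: "A \<preceq>\<^sub>L B \<Longrightarrow> B \<preceq>\<^sub>L C \<Longrightarrow> A \<preceq>\<^sub>L C"
  unfolding loewner_le_def using pos_semidef_add[of "B - A" "C - B"] by simp

lemma loewner_le_scaleR_mono: "pos_semidef A \<Longrightarrow> a \<le> b \<Longrightarrow> a *\<^sub>R A \<preceq>\<^sub>L b *\<^sub>R A"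
  unfolding loewner_le_def using pos_semidef_scaleR[of A "b - a"]
  by (simp add: scaleR_diff_left)

lemma pos_def_of_loewner_ge:
  assumes "pos_def A" "c > 0" "c *\<^sub>R A \<preceq>\<^sub>L X"
  shows "pos_def X"
proof -
  \<comment> \<open>\<open>X\<close> is not assumed Hermitian: it is the sum of the semidefinite
    difference and the Hermitian matrix \<open>c *\<^sub>R A\<close>.\<close>
  have "hermitian (X - c *\<^sub>R A + c *\<^sub>R A)"
    using assms by (intro hermitian_add hermitian_scaleR)
      (auto simp: loewner_le_def pos_semidef_def pos_def_def)
  then have X: "hermitian X" by simp
  then have "\<forall>x. c * (x \<bullet> (A *v x)) \<le> x \<bullet> (X *v x)"
    using assms by (simp add: loewner_le_iff hermitian_scaleR pos_def_imp_hermitian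
        matrix_vector_mult_scaleR_left)
  then show ?thesis
    using X assms(1,2) unfolding pos_def_iff by (meson less_le_trans mult_pos_pos)
qed

text \<open>On the curve \<tau> = 1/\<xi> the additional constraint holds with equality. Backwards,
  only the positive definiteness of \<open>X\<close> has to be recovered, and the lower bound at
  \<open>Y 1\<close> gives it.\<close>

lemma feasible_orig_iff_conv:
  assumes N: "N \<ge> 1" and Y: "\<forall>i\<in>{1..N}. pos_def (Y i)"
  shows "(X, t) \<in> feasible_orig Y N \<longleftrightarrow> (X, exp t, exp (- t)) \<in> feasible_conv Y N"
proof
  assume "(X, t) \<in> feasible_orig Y N"
  then show "(X, exp t, exp (- t)) \<in> feasible_conv Y N"
    by (auto simp: feasible_orig_def feasible_conv_def pos_def_imp_pos_semidef exp_minus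
        divide_inverse)
next
  assume F: "(X, exp t, exp (- t)) \<in> feasible_conv Y N"
  then have "exp (- t) *\<^sub>R Y 1 \<preceq>\<^sub>L X"
    using N by (auto simp: feasible_conv_def)
  then have "pos_def X"
    using pos_def_of_loewner_ge[of "Y 1" "exp (- t)" X] Y N by simp
  with F show "(X, t) \<in> feasible_orig Y N"
    by (auto simp: feasible_orig_def feasible_conv_def)
qed

lemma feasible_conv_imp_orig:
  assumes N: "N \<ge> 1" and Y: "\<forall>i\<in>{1..N}. pos_def (Y i)"
    and F: "(X, \<xi>, \<tau>) \<in> feasible_conv Y N"
  shows "\<xi> > 0" "(X, ln \<xi>) \<in> feasible_orig Y N"
proof -
  show xi: "\<xi> > 0" using F by (simp add: feasible_conv_def)
  \<comment> \<open>As \<open>Y i\<close> is semidefinite, 1/\<xi> \<le> \<tau> makes the smaller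
    multiple of \<open>Y i\<close> lie below the larger one, hence below \<open>X\<close>.\<close>
  have "(1 / \<xi>) *\<^sub>R Y i \<preceq>\<^sub>L X" if "i \<in> {1..N}" for i
    using loewner_le_trans loewner_le_scaleR_mono[of "Y i" "1 / \<xi>" \<tau>] F that
      pos_def_imp_pos_semidef[OF bspec[OF Y that]]
    by (force simp: feasible_conv_def)
  then have "(X, exp (ln \<xi>), exp (- ln \<xi>)) \<in> feasible_conv Y N"
    using F xi by (auto simp: feasible_conv_def exp_minus divide_inverse)
  then show "(X, ln \<xi>) \<in> feasible_orig Y N"
    using feasible_orig_iff_conv[OF N Y] by blast
qed

text \<open>The matrix constraints place linear expressions in (X, \<xi>, \<tau>) in the convex
  semidefinite cone, and the last constraint is the epigraph of \<xi> \<mapsto> 1/\<xi> on the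
  positive axis.\<close>

lemma convex_feasible_conv: "convex (feasible_conv Y N)"
proof -
  have ps: "pos_semidef (u *\<^sub>R A + v *\<^sub>R B)"
    if "pos_semidef A" "pos_semidef B" "0 \<le> u" "0 \<le> v" for A B :: "complex^'a^'a" and u v
    using that by (intro pos_semidef_add pos_semidef_scaleR)
  show ?thesis
  proof (rule convexI)
    fix p q :: "(complex^'a^'a) \<times> real \<times> real" and u v :: real
    assume p: "p \<in> feasible_conv Y N" and q: "q \<in> feasible_conv Y N"
      and uv: "0 \<le> u" "0 \<le> v" "u + v = 1"
    obtain X1 x1 t1 where p': "p = (X1, x1, t1)" by (cases p) auto
    obtain X2 x2 t2 where q': "q = (X2, x2, t2)" by (cases q) auto
    have P: "pos_semidef X1" "x1 > 0" "1 / x1 \<le> t1"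
      "\<And>i. i \<in> {1..N} \<Longrightarrow> pos_semidef (X1 - t1 *\<^sub>R Y i)"
      "\<And>i. i \<in> {1..N} \<Longrightarrow> pos_semidef (x1 *\<^sub>R Y i - X1)"
      using p by (auto simp: p' feasible_conv_def loewner_le_def)
    have Q: "pos_semidef X2" "x2 > 0" "1 / x2 \<le> t2"
      "\<And>i. i \<in> {1..N} \<Longrightarrow> pos_semidef (X2 - t2 *\<^sub>R Y i)"
      "\<And>i. i \<in> {1..N} \<Longrightarrow> pos_semidef (x2 *\<^sub>R Y i - X2)"
      using q by (auto simp: q' feasible_conv_def loewner_le_def)
    have "pos_semidef (u *\<^sub>R X1 + v *\<^sub>R X2 - (u * t1 + v * t2) *\<^sub>R Y i)"
      "pos_semidef ((u * x1 + v * x2) *\<^sub>R Y i - (u *\<^sub>R X1 + v *\<^sub>R X2))"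
      if "i \<in> {1..N}" for i
      using ps[OF P(4)[OF that] Q(4)[OF that] uv(1,2)] ps[OF P(5)[OF that] Q(5)[OF that] uv(1,2)]
      by (simp_all add: algebra_simps)
    moreover have "pos_semidef (u *\<^sub>R X1 + v *\<^sub>R X2)"
      using ps P(1) Q(1) uv(1,2) by blast
    \<comment> \<open>One weight may vanish: for u = 0 the other is 1, and positivity comes from
      \<open>x2\<close>.\<close>
    moreover have "u *\<^sub>R x1 + v *\<^sub>R x2 \<in> {0<..}"
      using P(2) Q(2) uv by (cases "u = 0") (auto intro: add_pos_nonneg)
    moreover have "1 / (u * x1 + v * x2) \<le> u * t1 + v * t2"
    proof -
      have "inverse (u *\<^sub>R x1 + v *\<^sub>R x2) \<le> u * inverse x1 + v * inverse x2"
        using convex_on_inverse[of "{0<..}"] P(2) Q(2) uv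
        by (auto simp: convex_on_def)
      also have "\<dots> \<le> u * t1 + v * t2"
        using P(3) Q(3) uv by (intro add_mono mult_left_mono) (auto simp: divide_inverse)
      finally show ?thesis by (simp add: divide_inverse)
    qed
    ultimately show "u *\<^sub>R p + v *\<^sub>R q \<in> feasible_conv Y N"
      by (simp add: p' q' feasible_conv_def loewner_le_def)
  qed
qed


section \<open>Compactness and the existence of a minimiser\<close>

lemma closed_pos_semidef: "closed {A :: complex^'n^'n. pos_semidef A}"
proof -
  have cont: "continuous_on UNIV (\<lambda>A :: complex^'n^'n. x \<bullet> (A *v x))" for x
    unfolding matrix_vector_mult_def inner_vec_def by (simp, intro continuous_intros)
  have "{A :: complex^'n^'n. pos_semidef A}
      = {A. \<forall>i j. cnj (A $ j $ i) = A $ i $ j} \<inter> {A. \<forall>x. 0 \<le> x \<bullet> (A *v x)}"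
    by (auto simp: pos_semidef_iff hermitian_def conj_transpose_def vec_eq_iff)
  also have "closed \<dots>"
    by (intro closed_Int closed_Collect_all closed_Collect_eq closed_Collect_le cont continuous_intros)
  finally show ?thesis .
qed

lemma inner_matrix_le_onorm:
  fixes A :: "complex^'n^'n"
  shows "x \<bullet> (A *v x) \<le> onorm ((*v) A) * (norm x)\<^sup>2"
proof -
  have "x \<bullet> (A *v x) \<le> norm x * norm (A *v x)"
    by (rule norm_cauchy_schwarz)
  also have "\<dots> \<le> norm x * (onorm ((*v) A) * norm x)"
    using linear_matrix_vector_mult[of A]
    by (intro mult_left_mono onorm) (auto simp: linear_conv_bounded_linear)
  finally show ?thesis by (simp add: power2_eq_square mult_ac)
qed

text \<open>The eigenvalues lie between 0 and c, so the operator norm is at most c and bounds every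
  entry; the norm of \<open>X\<close> is at most the sum of the moduli of its entries. The crude
  constant suffices, since the lemma serves only to prove boundedness.\<close>

lemma norm_pos_semidef_le:
  fixes X :: "complex^'n^'n" and c :: real
  assumes X: "pos_semidef X" and le: "\<And>x. x \<bullet> (X *v x) \<le> c * (norm x)\<^sup>2"
  shows "norm X \<le> CARD('n) * (CARD('n) * c)"
proof -
  have "hermitian X" using X by (simp add: pos_semidef_def)
  then obtain U d where U: "unitary U" and Xeq: "X = U ** real_diag d ** conj_transpose U"
    using spectral_decomposition by blast
  have "0 \<le> d i" "d i \<le> c" for i
    using spectral_form_ge_iff[OF U, of 0 d] spectral_form_le_iff[OF U, of d c] X le
    by (auto simp: Xeq[symmetric] pos_semidef_iff)
  then have on: "onorm ((*v) X) \<le> c"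
    using spectral_norm_le_iff[OF U, of d c] by (simp add: Xeq[symmetric] spectral_norm_def)
  have "norm (X $ i $ j) \<le> c" for i j
  proof -
    have "X $ i $ j = (X *v axis j 1) $ i"
      by (simp add: matrix_vector_mult_def axis_def if_distrib cong: if_cong)
    also have "norm \<dots> \<le> norm (X *v axis j 1)"
      by (rule Finite_Cartesian_Product.norm_nth_le)
    also have "\<dots> \<le> onorm ((*v) X) * norm (axis j (1::complex))"
      using linear_matrix_vector_mult[of X]
      by (intro onorm) (auto simp: linear_conv_bounded_linear)
    finally show ?thesis using on by (simp add: norm_axis_one)
  qed
  then have "(\<Sum>i\<in>UNIV. \<Sum>j\<in>UNIV. norm (X $ i $ j)) 
      \<le> (\<Sum>i\<in>(UNIV::'n set). \<Sum>j\<in>(UNIV::'n set). c)"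
    by (intro sum_mono)
  moreover have "norm X \<le> (\<Sum>i\<in>UNIV. \<Sum>j\<in>UNIV. norm (X $ i $ j))"
    unfolding norm_vec_def
    by (intro order_trans[OF L2_set_le_sum] sum_mono) (auto simp: L2_set_nonneg)
  ultimately show ?thesis by simp
qed

lemma thompson_dist_nonneg: "0 \<le> thompson_dist A B"
  using linear_matrix_vector_mult
  by (simp add: thompson_dist_def spectral_norm_def onorm_pos_le linear_conv_bounded_linear)

lemma max_thompson_dist_nonneg: "N \<ge> 1 \<Longrightarrow> 0 \<le> max_thompson_dist Y N X"
  unfolding max_thompson_dist_def
  by (subst Max_ge_iff) (auto intro: thompson_dist_nonneg exI[of _ 1] bexI[of _ 1])

text \<open>Minimising t over feasible pairs (X, t) replaces minimising the distance itself, so that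
  only the projection \<open>snd\<close> has to be continuous, not the Thompson distance.\<close>

lemma max_thompson_dist_attains_min:
  fixes Y :: "nat \<Rightarrow> complex^'n^'n"
  assumes N: "N \<ge> 1" and Y: "\<forall>i\<in>{1..N}. pos_def (Y i)"
  obtains X0 where "pos_def X0"
    "\<And>X. pos_def X \<Longrightarrow> max_thompson_dist Y N X0 \<le> max_thompson_dist Y N X"
proof -
  let ?f = "max_thompson_dist Y N"
  note feas = feasible_orig_iff[OF N Y]
  have Y1: "pos_def (Y 1)" using N Y by simp
  define T where "T = ?f (Y 1)"
  \<comment> \<open>The cutoff at 0 discards no pair of the form (X, \<open>?f X\<close>), because
    distances are nonnegative.\<close>
  define K where "K = feasible_orig Y N \<inter> (UNIV \<times> {0..T})"
  \<comment> \<open>On \<open>K\<close> the form of \<open>X\<close> is at most \<open>exp T\<close>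
    times that of \<open>Y 1\<close>, which the operator norm of \<open>Y 1\<close> bounds; the two
    factors \<open>CARD('n)\<close> come from \<open>norm_pos_semidef_le\<close>.\<close>
  define R where "R = CARD('n) * (CARD('n) * (exp T * onorm ((*v) (Y 1))))"
  have "K \<subseteq> cball 0 R \<times> {0..T}"
  proof clarify
    fix X t assume K: "(X, t) \<in> K"
    then have X: "pos_def X" and t: "0 \<le> t" "t \<le> T" and le: "X \<preceq>\<^sub>L exp t *\<^sub>R Y 1"
      using N by (auto simp: K_def feasible_orig_def)
    have "X \<preceq>\<^sub>L exp T *\<^sub>R Y 1"
      by (intro loewner_le_trans[OF le] loewner_le_scaleR_mono pos_def_imp_pos_semidef Y1)
        (use t in simp)
    then have le': "x \<bullet> (X *v x) \<le> exp T * (x \<bullet> (Y 1 *v x))" for x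
      using X Y1
      by (simp add: loewner_le_iff hermitian_scaleR pos_def_imp_hermitian
          matrix_vector_mult_scaleR_left)
    have "x \<bullet> (X *v x) \<le> (exp T * onorm ((*v) (Y 1))) * (norm x)\<^sup>2" for x
      using order_trans[OF le' mult_left_mono[OF inner_matrix_le_onorm]] by (simp add: mult_ac)
    then have "norm X \<le> R"
      unfolding R_def by (rule norm_pos_semidef_le[OF pos_def_imp_pos_semidef[OF X]])
    then show "X \<in> cball 0 R \<and> t \<in> {0..T}" using t by simp
  qed
  then have bdd: "bounded K"
    by (rule bounded_subset[rotated]) (intro bounded_Times bounded_cball bounded_closed_interval)
  have "K = (\<Inter>i\<in>{1..N}. (\<lambda>(X, t). X - exp (- t) *\<^sub>R Y i) -` {A. pos_semidef A}
            \<inter> (\<lambda>(X, t). exp t *\<^sub>R Y i - X) -` {A. pos_semidef A}) \<inter> (UNIV \<times> {0..T})"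
  proof -
    \<comment> \<open>This removes the open condition \<open>pos_def X\<close> from the description
      of \<open>K\<close>, leaving preimages of the closed semidefinite cone.\<close>
    have "pos_def X" if "\<forall>i\<in>{1..N}. pos_semidef (X - exp (- t) *\<^sub>R Y i)" for X t
      using that N
      by (intro pos_def_of_loewner_ge[OF Y1, of "exp (- t)"]) (auto simp: loewner_le_def)
    then show ?thesis
      by (auto simp: K_def feasible_orig_def loewner_le_def) blast
  qed
  also have "closed \<dots>"
    unfolding case_prod_unfold
    by (intro closed_Int closed_INT ballI closed_vimage closed_pos_semidef closed_Times
        closed_UNIV closed_atLeastAtMost continuous_intros)
  finally have "compact K" using bdd by (simp add: compact_eq_bounded_closed)
  moreover have "(Y 1, T) \<in> K"
    using N Y1 by (simp add: K_def feas T_def max_thompson_dist_nonneg)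
  moreover have "continuous_on K snd"
    by (intro continuous_intros)
  ultimately obtain p where p: "p \<in> K" and pmin: "\<And>q. q \<in> K \<Longrightarrow> snd p \<le> snd q"
    using continuous_attains_inf[of K snd] by blast
  obtain X0 t0 where p': "p = (X0, t0)" by (cases p)
  have X0: "pos_def X0" "?f X0 \<le> t0" "t0 \<le> T"
    using p by (auto simp: p' K_def feas)
  have "?f X0 \<le> ?f X" if "pos_def X" for X
  \<comment> \<open>Only competitors with value at most T give a point of \<open>K\<close>; any
    other has a value above T, hence above that of \<open>X0\<close>.\<close>
  proof (cases "?f X \<le> T")
    case True
    then have "(X, ?f X) \<in> K"
      using that N by (simp add: K_def feas max_thompson_dist_nonneg)
    from pmin[OF this] show ?thesis using X0 by (simp add: p')
  qed (use X0 in simp)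
  with X0 that show thesis by blast
qed

theorem mainTheorem3:
  fixes Y :: "nat \<Rightarrow> complex^'n^'n" and N :: nat
  assumes "N \<ge> 1"
    and "\<And>i. i \<in> {1..N} \<Longrightarrow> pos_def (Y i)"
  shows "\<exists>t_star :: real.
      is_min_value (\<lambda>(_, t). t) (feasible_orig Y N) t_star \<and>
      is_min_value (max_thompson_dist Y N) {X. pos_def X} t_star \<and>
      (\<forall>X t. (X, t) \<in> feasible_orig Y N \<longleftrightarrow> (X, exp t, exp (- t)) \<in> feasible_conv Y N) \<and>
      convex (feasible_conv Y N) \<and>
      is_min_value (\<lambda>(_, \<xi>, _). \<xi>) (feasible_conv Y N) (exp t_star) \<and>
      (\<forall>X. (pos_def X \<and> max_thompson_dist Y N X = t_star) \<longleftrightarrow>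
           (\<exists>\<tau>. is_arg_min (\<lambda>(_, \<xi>, _). \<xi>) (\<lambda>p. p \<in> feasible_conv Y N) (X, exp t_star, \<tau>)))"
proof -
  have Y: "\<forall>i\<in>{1..N}. pos_def (Y i)" using assms(2) by blast
  note feas = feasible_orig_iff[OF assms(1) Y]
  note conv = feasible_orig_iff_conv[OF assms(1) Y]
  obtain X0 where X0: "pos_def X0"
    and min: "\<And>X. pos_def X \<Longrightarrow> max_thompson_dist Y N X0 \<le> max_thompson_dist Y N X"
    using max_thompson_dist_attains_min[OF assms(1) Y] by blast
  define s where "s = max_thompson_dist Y N X0"
  have orig_ge: "s \<le> t" if "(X, t) \<in> feasible_orig Y N" for X t
    using that min[of X] by (simp add: feas s_def)
  have conv_ge: "exp s \<le> \<xi>" if "(X, \<xi>, \<tau>) \<in> feasible_conv Y N" for X \<xi> \<tau>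
    using feasible_conv_imp_orig[OF assms(1) Y that] orig_ge by (metis exp_le_cancel_iff exp_ln)
  \<comment> \<open>Since \<open>exp s\<close> is a lower bound for \<xi>, every feasible triple
    with this value is a minimiser, whatever its \<tau>.\<close>
  have argmin: "is_arg_min (\<lambda>(_, \<xi>, _). \<xi>) (\<lambda>p. p \<in> feasible_conv Y N) (X, exp s, \<tau>)
      \<longleftrightarrow> (X, exp s, \<tau>) \<in> feasible_conv Y N" for X \<tau>
    using conv_ge by (force simp: is_arg_min_def not_less)
  have sX0: "(X0, s) \<in> feasible_orig Y N"
    using X0 by (simp add: feas s_def)
  have "is_min_value (\<lambda>(_, t). t) (feasible_orig Y N) s"
    unfolding is_min_value_def is_arg_min_def
    using sX0 orig_ge by (intro exI[of _ "(X0, s)"]) (force simp: not_less)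
  moreover have "is_min_value (max_thompson_dist Y N) {X. pos_def X} s"
    unfolding is_min_value_def is_arg_min_def
    using X0 min by (intro exI[of _ X0]) (force simp: not_less s_def)
  moreover have "is_min_value (\<lambda>(_, \<xi>, _). \<xi>) (feasible_conv Y N) (exp s)"
    unfolding is_min_value_def
    using sX0 argmin conv by (intro exI[of _ "(X0, exp s, exp (- s))"]) simp
  moreover have "(pos_def X \<and> max_thompson_dist Y N X = s) \<longleftrightarrow>
      (\<exists>\<tau>. is_arg_min (\<lambda>(_, \<xi>, _). \<xi>) (\<lambda>p. p \<in> feasible_conv Y N) (X, exp s, \<tau>))" for X
  proof
    assume "pos_def X \<and> max_thompson_dist Y N X = s"
    then have "(X, s) \<in> feasible_orig Y N" by (simp add: feas)
    then show "\<exists>\<tau>. is_arg_min (\<lambda>(_, \<xi>, _). \<xi>) (\<lambda>p. p \<in> feasible_conv Y N) (X, exp s, \<tau>)"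
      using argmin conv by blast
  next
    assume "\<exists>\<tau>. is_arg_min (\<lambda>(_, \<xi>, _). \<xi>) (\<lambda>p. p \<in> feasible_conv Y N) (X, exp s, \<tau>)"
    then obtain \<tau> where "(X, exp s, \<tau>) \<in> feasible_conv Y N" using argmin by blast
    \<comment> \<open>Feasibility at level s gives distance at most s, and the minimality of
      \<open>X0\<close> gives the reverse inequality.\<close>
    from feasible_conv_imp_orig(2)[OF assms(1) Y this] have "(X, s) \<in> feasible_orig Y N" by simp
    then show "pos_def X \<and> max_thompson_dist Y N X = s"
      using min[of X] by (auto simp: feas s_def)
  qed
  ultimately show ?thesis
    using conv convex_feasible_conv by (intro exI[of _ s]) blast
qed

end
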